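(* Let $s>13$ be an integer. Every $[1,s]$-almost intersecting graph has at most $2s+2$ edges, and the only graph (up to isomorphism and ignoring isolated vertices) with exactly $2s+2$ edges having this property is the complete bipartite graph $K_{2,s+1}$.
   Context: A graph here is a finite simple graph, viewed as a 2-uniform hypergraph (set of 2-element edges). It is $[1,s]$-almost intersecting if every edge is disjoint from at least $1$ and at most $s$ other edges. *)

theory Defs
  imports Main
begin

text \<open>A graph is identified with its edge set, so isolated vertices are not represented
  and the vertices of \<open>E\<close> are the elements of \<open>\<Union>E\<close>.\<close>

definition fin_simple_graph :: "'a set set \<Rightarrow> bool" where
  "fin_simple_graph E \<longleftrightarrow> finite E \<and> (\<forall>e\<in>E. card e = 2)"

definition almost_intersecting :: "nat \<Rightarrow> nat \<Rightarrow> 'a set set \<Rightarrow> bool" where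
  "almost_intersecting a b E \<longleftrightarrow>
     (\<forall>e\<in>E. a \<le> card {f \<in> E. f \<noteq> e \<and> f \<inter> e = {}} \<and>
             card {f \<in> E. f \<noteq> e \<and> f \<inter> e = {}} \<le> b)"

definition graph_isomorphic :: "'a set set \<Rightarrow> 'b set set \<Rightarrow> bool" where
  "graph_isomorphic E F \<longleftrightarrow> (\<exists>\<phi>. bij_betw \<phi> (\<Union>E) (\<Union>F) \<and> (\<lambda>e. \<phi> ` e) ` E = F)"

definition complete_bipartite :: "nat \<Rightarrow> nat \<Rightarrow> (nat + nat) set set" where
  "complete_bipartite m n = {{Inl i, Inr j} | i j. i < m \<and> j < n}"

end

theory Submission
  imports Defs
begin

text \<open>Write \<open>m\<close> for the number of edges and \<open>d\<close> for the degree. Inclusion-exclusion turns the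
  hypothesis into \<open>d u + d v \<ge> m + 1 - s\<close> for every edge \<open>uv\<close>. Assume \<open>m \<ge> 2s + 2\<close> and take disjoint
  edges \<open>uv\<close> and \<open>xy\<close>. Their degrees sum to at least \<open>m + 4\<close>, while at most six edges are counted
  twice, so at most two edges miss \<open>{u, v, x, y}\<close> and every other vertex has degree at most 6.
  If \<open>u\<close> and \<open>x\<close> are the ends of larger degree, they have neighbours outside \<open>{u, v, x, y}\<close>, hence
  degree at least \<open>m - s - 5\<close>, and at most nine edges miss \<open>{u, x}\<close>. The degree sum of such an edge
  would be at most \<open>14 < s + 3\<close>, so every edge meets \<open>{u, x}\<close>. Then all other vertices
  have degree at most 2, and the degree condition forces \<open>K\<^sub>2\<^sub>,\<^sub>s\<^sub>+\<^sub>1\<close>.\<close>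

section \<open>Degrees and edges avoiding a vertex set\<close>

definition degree :: "'a set set \<Rightarrow> 'a \<Rightarrow> nat" where
  "degree E v = card {e \<in> E. v \<in> e}"

text \<open>Kept as a set of edges rather than a number, because it is itself a graph whose own
  degrees enter \<open>degree_le\<close> and \<open>two_hubs\<close>.\<close>

definition missing :: "'a set set \<Rightarrow> 'a set \<Rightarrow> 'a set set" where
  "missing E S = {e \<in> E. e \<inter> S = {}}"

lemma fin_simple_graph_subset:
  "fin_simple_graph E \<Longrightarrow> F \<subseteq> E \<Longrightarrow> fin_simple_graph F"
  unfolding fin_simple_graph_def by (meson finite_subset subset_iff)

lemma fin_simple_graph_missing: "fin_simple_graph E \<Longrightarrow> fin_simple_graph (missing E S)"
  by (rule fin_simple_graph_subset) (auto simp: missing_def)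

lemma edge_obtain:
  assumes "fin_simple_graph E" "e \<in> E"
  obtains u v where "e = {u, v}" "u \<noteq> v"
  using assms unfolding fin_simple_graph_def by (meson card_2_iff)

lemma edge_obtain_at:
  assumes "fin_simple_graph E" "e \<in> E" "u \<in> e"
  obtains v where "e = {u, v}" "u \<noteq> v"
  using edge_obtain[OF assms(1,2)] assms(3) by (metis doubleton_eq_iff insertE singletonD)

lemma no_loop: "fin_simple_graph E \<Longrightarrow> {u, v} \<in> E \<Longrightarrow> u \<noteq> v"
  unfolding fin_simple_graph_def by force

text \<open>An edge is nonempty and so meets itself; hence the edges counted for \<open>e\<close>
  are exactly those of \<open>missing E e\<close>.\<close>

lemma almost_intersecting_iff:
  assumes "fin_simple_graph E"
  shows "almost_intersecting a b E \<longleftrightarrow>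
    (\<forall>e\<in>E. a \<le> card (missing E e) \<and> card (missing E e) \<le> b)"
proof -
  have "{f \<in> E. f \<noteq> e \<and> f \<inter> e = {}} = missing E e" if "e \<in> E" for e
    using edge_obtain[OF assms that] unfolding missing_def by auto
  then show ?thesis
    unfolding almost_intersecting_def by auto
qed

text \<open>Double counting of pairs of an edge and a vertex of \<open>S\<close> on it. The
  correction terms account for edges with no end or both ends in \<open>S\<close>.\<close>

lemma sum_degree:
  assumes G: "fin_simple_graph E" and S: "finite S"
  shows "(\<Sum>v\<in>S. degree E v) + card (missing E S) = card E + card {e \<in> E. e \<subseteq> S}"
proof -
  have fin: "finite E"
    using G by (simp add: fin_simple_graph_def)
  have "(\<Sum>v\<in>S. degree E v) = (\<Sum>v\<in>S. \<Sum>e\<in>E. if v \<in> e then 1 else 0)"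
    using fin by (simp add: degree_def flip: sum.inter_filter)
  also have "\<dots> = (\<Sum>e\<in>E. \<Sum>v\<in>S. if v \<in> e then 1 else 0)"
    by (rule sum.swap)
  also have "\<dots> = (\<Sum>e\<in>E. card {v \<in> S. v \<in> e})"
    using S by (simp flip: sum.inter_filter)
  finally have sw: "(\<Sum>v\<in>S. degree E v) = (\<Sum>e\<in>E. card {v \<in> S. v \<in> e})" .
  have miss: "card (missing E S) = (\<Sum>e\<in>E. if e \<inter> S = {} then 1 else 0)"
    using fin by (simp add: missing_def flip: sum.inter_filter)
  have inside: "card {e \<in> E. e \<subseteq> S} = (\<Sum>e\<in>E. if e \<subseteq> S then 1 else 0)"
    using fin by (simp flip: sum.inter_filter)
  \<comment> \<open>If \<open>e\<close> has 0, 1 or 2 ends in \<open>S\<close>, both sides are 1, 1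
    and 2 respectively.\<close>
  have pt: "card {v \<in> S. v \<in> e} + (if e \<inter> S = {} then 1 else 0) = 1 + (if e \<subseteq> S then 1 else 0)"
    if "e \<in> E" for e
  proof -
    obtain a b where e: "e = {a, b}" "a \<noteq> b"
      using edge_obtain[OF G \<open>e \<in> E\<close>] .
    have "{v \<in> S. v \<in> e} = (if a \<in> S then {a} else {}) \<union> (if b \<in> S then {b} else {})"
      using e by auto
    then show ?thesis
      using e by auto
  qed
  have "(\<Sum>v\<in>S. degree E v) + card (missing E S)
      = (\<Sum>e\<in>E. card {v \<in> S. v \<in> e} + (if e \<inter> S = {} then 1 else 0))"
    unfolding sw miss by (simp add: sum.distrib)
  also have "\<dots> = (\<Sum>e\<in>E. 1 + (if e \<subseteq> S then 1 else 0))"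
    using pt by (intro sum.cong) auto
  also have "\<dots> = card E + card {e \<in> E. e \<subseteq> S}"
    unfolding inside by (simp only: sum.distrib) simp
  finally show ?thesis .
qed

lemma degree_pair:
  assumes G: "fin_simple_graph E" and "u \<noteq> v"
  shows "degree E u + degree E v + card (missing E {u, v}) =
    card E + (if {u, v} \<in> E then 1 else 0)"
proof -
  have "e \<in> E \<Longrightarrow> e \<subseteq> {u, v} \<Longrightarrow> e = {u, v}" for e
    by (rule card_subset_eq) (use G \<open>u \<noteq> v\<close> in \<open>auto simp: fin_simple_graph_def\<close>)
  then have "{e \<in> E. e \<subseteq> {u, v}} = (if {u, v} \<in> E then {{u, v}} else {})"
    by (auto)
  then show ?thesis
    using sum_degree[OF G, of "{u, v}"] \<open>u \<noteq> v\<close> by (auto split: if_splits)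
qed

text \<open>An edge at \<open>w\<close> either ends in \<open>S\<close>, with at most one edge per
  vertex of \<open>S\<close>, or avoids \<open>S\<close> altogether.\<close>

lemma degree_le:
  assumes G: "fin_simple_graph E" and S: "finite S"
    and w: "w \<notin> S"
  shows "degree E w \<le> card S + degree (missing E S) w"
proof -
  have "{e \<in> E. w \<in> e} \<subseteq> (\<lambda>v. {w, v}) ` S \<union> {e \<in> missing E S. w \<in> e}"
  proof
    fix e assume e: "e \<in> {e \<in> E. w \<in> e}"
    then obtain v where "e = {w, v}"
      using edge_obtain_at[OF G] by blast
    then show "e \<in> (\<lambda>v. {w, v}) ` S \<union> {e \<in> missing E S. w \<in> e}"
      using e w by (auto simp: missing_def)
  qed
  moreover have "finite {e \<in> missing E S. w \<in> e}"
    using G by (simp add: missing_def fin_simple_graph_def)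
  ultimately have "degree E w \<le> card ((\<lambda>v. {w, v}) ` S \<union> {e \<in> missing E S. w \<in> e})"
    unfolding degree_def using S by (intro card_mono) auto
  also have "\<dots> \<le> card ((\<lambda>v. {w, v}) ` S) + degree (missing E S) w"
    unfolding degree_def by (rule card_Un_le)
  also have "\<dots> \<le> card S + degree (missing E S) w"
    using S by (simp add: card_image_le)
  finally show ?thesis .
qed

text \<open>Pigeonhole: distinct edges at \<open>u\<close> have distinct other ends, and
  \<open>S\<close> has too few vertices to hold them all.\<close>

lemma neighbour_outside:
  assumes G: "fin_simple_graph E" and S: "finite S" and "card S < degree E u"
  obtains w where "{u, w} \<in> E" "w \<notin> S"
proof -
  have "\<not> {e \<in> E. u \<in> e} \<subseteq> (\<lambda>v. {u, v}) ` S"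
  proof
    assume "{e \<in> E. u \<in> e} \<subseteq> (\<lambda>v. {u, v}) ` S"
    then have "degree E u \<le> card ((\<lambda>v. {u, v}) ` S)"
      unfolding degree_def using S by (intro card_mono) auto
    also have "\<dots> \<le> card S"
      using S by (rule card_image_le)
    finally show False
      using assms(3) by simp
  qed
  then obtain e where e: "e \<in> E" "u \<in> e" "e \<notin> (\<lambda>v. {u, v}) ` S"
    by auto
  obtain w where "e = {u, w}"
    using edge_obtain_at[OF G e(1,2)] .
  then show thesis
    using that[of w] e by auto
qed

lemma degree_le_card: "finite E \<Longrightarrow> degree E v \<le> card E"
  unfolding degree_def by (intro card_mono) auto

lemma edges_inside_le:
  assumes G: "fin_simple_graph E" and S: "finite S"
  shows "card {e \<in> E. e \<subseteq> S} \<le> card S choose 2"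
proof -
  have "{e \<in> E. e \<subseteq> S} \<subseteq> {e. e \<subseteq> S \<and> card e = 2}"
    using G by (auto simp: fin_simple_graph_def)
  then have "card {e \<in> E. e \<subseteq> S} \<le> card {e. e \<subseteq> S \<and> card e = 2}"
    using S by (intro card_mono) auto
  then show ?thesis
    using n_subsets[OF S, of 2] by simp
qed

section \<open>Degree conditions in almost intersecting graphs\<close>

lemma degree_sum_ge:
  assumes "fin_simple_graph E" "almost_intersecting 1 s E" "{u, v} \<in> E"
  shows "card E + 1 \<le> degree E u + degree E v + s"
  using degree_pair[OF assms(1) no_loop[OF assms(1,3)]] assms
  by (auto simp: almost_intersecting_iff[OF assms(1)] dest!: bspec[of _ _ "{u, v}"])

lemma edge_larger_end:
  assumes G: "fin_simple_graph E" and "e \<in> E"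
  obtains u v where "e = {u, v}" "degree E v \<le> degree E u"
  using edge_obtain[OF assms] by (metis insert_commute nat_le_linear)

text \<open>The bound 3 exceeds \<open>card {u, x}\<close>, so that each hub has a neighbour outside
  \<open>{u, x}\<close>; \<open>extremal_structure\<close> relies on this.\<close>

lemma two_hubs:
  assumes G: "fin_simple_graph E" and A: "almost_intersecting 1 s E"
    and s: "s > 13" and m: "2 * s + 2 \<le> card E"
  obtains u x where "u \<noteq> x" "missing E {u, x} = {}" "3 \<le> degree E u" "3 \<le> degree E x"
proof -
  have fin: "finite E"
    using G by (simp add: fin_simple_graph_def)
  have "E \<noteq> {}"
    using m by auto
  then obtain e where e: "e \<in> E"
    by auto
  then have "missing E e \<noteq> {}"
    using A by (auto simp: almost_intersecting_iff[OF G] dest!: bspec[of _ _ e])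
  then obtain f where f: "f \<in> E" "f \<inter> e = {}"
    by (auto simp: missing_def)
  obtain u v where uv: "e = {u, v}" "degree E v \<le> degree E u"
    using edge_larger_end[OF G e] .
  obtain x y where xy: "f = {x, y}" "degree E y \<le> degree E x"
    using edge_larger_end[OF G f(1)] .
  define S where "S = {u, v, x, y}"
  have "u \<noteq> v" "x \<noteq> y"
    using no_loop[OF G] e f uv xy by auto
  then have dist: "distinct [u, v, x, y]"
    using f uv xy by auto
  have S: "finite S" "card S = 4"
    using dist by (auto simp: S_def)
  have sums: "card E + 1 \<le> degree E u + degree E v + s" "card E + 1 \<le> degree E x + degree E y + s"
    using degree_sum_ge[OF G A] e f uv xy by auto
  \<comment> \<open>Four vertices span at most \<open>4 choose 2\<close> edges.\<close>
  have "card {e \<in> E. e \<subseteq> S} \<le> 6"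
    using edges_inside_le[OF G S(1)] S(2) by (simp add: choose_two)
  moreover have "(\<Sum>v\<in>S. degree E v) = degree E u + degree E v + degree E x + degree E y"
    using dist by (simp add: S_def)
  ultimately have few: "card (missing E S) \<le> 2"
    using sum_degree[OF G S(1)] sums m by linarith
  \<comment> \<open>At most 4 edges from \<open>w\<close> into \<open>S\<close>, plus at most 2 that
    avoid \<open>S\<close>.\<close>
  have outside: "degree E w \<le> 6" if "w \<notin> S" for w
    using degree_le[OF G S(1) that] S(2) few
      degree_le_card[of "missing E S" w] fin by (auto simp: missing_def)
  have hub: "card E \<le> degree E z + s + 5" if "4 < degree E z" for z
  proof -
    obtain w where "{z, w} \<in> E" "w \<notin> S"
      using neighbour_outside[OF G S(1), of z] S(2) \<open>4 < degree E z\<close> by metis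
    then show ?thesis
      using degree_sum_ge[OF G A, of z w] outside[of w] by linarith
  qed
  \<comment> \<open>The larger end carries at least half of \<open>card E + 1 - s\<close>, which is
    at least \<open>s + 3 > 16\<close>.\<close>
  have big: "4 < degree E u" "4 < degree E x"
    using sums uv(2) xy(2) m s by linarith+
  have "u \<noteq> x"
    using dist by auto
  \<comment> \<open>Each hub has degree at least \<open>card E - s - 5\<close>, and
    \<open>{u, x}\<close> may be an edge: at most \<open>2 * s + 11 - card E\<close> edges avoid
    both.\<close>
  have m9: "card (missing E {u, x}) \<le> 9"
    using degree_pair[OF G \<open>u \<noteq> x\<close>] hub[OF big(1)] hub[OF big(2)] m by (auto split: if_splits)
  have "missing E {u, x} = {}"
  proof (rule ccontr)
    define M where "M = missing E {u, x}"
    assume "missing E {u, x} \<noteq> {}"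
    then obtain g where g: "g \<in> M"
      by (auto simp: M_def)
    have GM: "fin_simple_graph M"
      unfolding M_def by (rule fin_simple_graph_missing[OF G])
    obtain a b where ab: "g = {a, b}" "a \<noteq> b"
      using edge_obtain[OF GM g] .
    have ab_E: "{a, b} \<in> E" "a \<notin> {u, x}" "b \<notin> {u, x}"
      using g ab by (auto simp: M_def missing_def)
    have "degree E a \<le> 2 + degree M a" "degree E b \<le> 2 + degree M b"
      using degree_le[OF G _ ab_E(2)] degree_le[OF G _ ab_E(3)] \<open>u \<noteq> x\<close> by (auto simp: M_def)
    \<comment> \<open>Within \<open>M\<close> only the edge \<open>{a, b}\<close> is counted twice,
      so the sum is at most \<open>card M + 1\<close>.\<close>
    moreover have "degree M a + degree M b \<le> 10"
      using degree_pair[OF GM ab(2)] g ab(1) m9 by (simp add: M_def)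
    ultimately show False
      using degree_sum_ge[OF G A ab_E(1)] m s by linarith
  qed
  then show thesis
    using that[of u x] big \<open>u \<noteq> x\<close> by auto
qed

text \<open>Assuming only a lower bound on \<open>card E\<close> lets one lemma serve both claims:
  the conclusion \<open>card E = 2 * s + 2\<close> rules out larger graphs, and the form of
  \<open>E\<close> gives uniqueness.\<close>

lemma extremal_structure:
  assumes G: "fin_simple_graph E" and A: "almost_intersecting 1 s E"
    and s: "s > 13" and m: "2 * s + 2 \<le> card E"
  obtains u x N where "u \<noteq> x" "u \<notin> N" "x \<notin> N" "finite N" "card N = s + 1"
    "E = {{z, w} | z w. z \<in> {u, x} \<and> w \<in> N}" "card E = 2 * s + 2"
proof -
  obtain u x where ux: "u \<noteq> x" and cover: "missing E {u, x} = {}"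
    and deg3: "3 \<le> degree E u" "3 \<le> degree E x"
    using two_hubs[OF assms] .
  \<comment> \<open>No edge avoids \<open>{u, x}\<close>, whereas every edge must be disjoint from
    at least one other.\<close>
  have "{u, x} \<notin> E"
    using A cover by (auto simp: almost_intersecting_iff[OF G] dest!: bspec[of _ _ "{u, x}"])
  then have sum: "degree E u + degree E x = card E"
    using degree_pair[OF G ux] cover by simp
  have deg2: "degree E w \<le> 2" if "w \<notin> {u, x}" for w
    using degree_le[OF G _ that] cover ux by (auto simp: degree_def)
  have ge: "card E \<le> degree E z + s + 1" if "z \<in> {u, x}" for z
  proof -
    have "card {u, x} < degree E z"
      using that deg3 ux by auto
    then obtain w where "{z, w} \<in> E" "w \<notin> {u, x}"
      using neighbour_outside[OF G, of "{u, x}" z] by auto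
    then show ?thesis
      using degree_sum_ge[OF G A, of z w] deg2[of w] by linarith
  qed
  \<comment> \<open>Adding \<open>ge\<close> for both hubs gives
    \<open>2 * card E \<le> card E + 2 * s + 2\<close>; with \<open>m\<close> all these inequalities
    are tight.\<close>
  have card_E: "card E = 2 * s + 2" and deg: "degree E u = s + 1" "degree E x = s + 1"
    using sum ge[of u] ge[of x] m by auto
  have edge_form: "\<exists>z w. e = {z, w} \<and> z \<in> {u, x} \<and> w \<notin> {u, x}" if e: "e \<in> E" for e
  proof -
    have "e \<notin> missing E {u, x}"
      using cover by simp
    then obtain z where z: "z \<in> e" "z \<in> {u, x}"
      using e by (auto simp: missing_def)
    obtain w where w: "e = {z, w}" "z \<noteq> w"
      using edge_obtain_at[OF G e z(1)] .
    then have "w \<notin> {u, x}"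
      using z \<open>{u, x} \<notin> E\<close> e by (auto simp: insert_commute)
    then show ?thesis
      using w z by auto
  qed
  \<comment> \<open>A vertex \<open>w\<close> joined to only one hub has degree 1, so the degree
    condition on that edge would read \<open>2 * s + 3 \<le> (s + 1) + 1 + s\<close>.\<close>
  have both: "{u, w} \<in> E \<and> {x, w} \<in> E" if zw: "{z, w} \<in> E" "z \<in> {u, x}" "w \<notin> {u, x}" for z w
  proof (rule ccontr)
    assume not_both: "\<not> ({u, w} \<in> E \<and> {x, w} \<in> E)"
    have "{e \<in> E. w \<in> e} \<subseteq> {{z, w}}"
    proof
      fix e assume "e \<in> {e \<in> E. w \<in> e}"
      then show "e \<in> {{z, w}}"
        using edge_form[of e] zw not_both by auto
    qed
    then have "degree E w \<le> 1"
      unfolding degree_def using card_mono[of "{{z, w}}"] by fastforce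
    then show False
      using degree_sum_ge[OF G A zw(1)] zw(2) deg card_E by auto
  qed
  define N where "N = {w. {u, w} \<in> E}"
  have "u \<notin> N" "x \<notin> N"
    using no_loop[OF G, of u u] \<open>{u, x} \<notin> E\<close> by (auto simp: N_def)
  have star: "bij_betw (\<lambda>w. {u, w}) N {e \<in> E. u \<in> e}"
    unfolding bij_betw_def
  proof
    show "inj_on (\<lambda>w. {u, w}) N"
      by (auto simp: inj_on_def doubleton_eq_iff)
    show "(\<lambda>w. {u, w}) ` N = {e \<in> E. u \<in> e}"
      using edge_obtain_at[OF G, of _ u] by (auto simp: N_def)
  qed
  then have "card N = s + 1"
    using bij_betw_same_card[OF star] deg by (simp add: degree_def)
  have "E = {{z, w} | z w. z \<in> {u, x} \<and> w \<in> N}"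
  proof (intro equalityI subsetI)
    fix e assume "e \<in> E"
    then show "e \<in> {{z, w} | z w. z \<in> {u, x} \<and> w \<in> N}"
      using edge_form[of e] both by (auto simp: N_def)
  next
    fix e assume "e \<in> {{z, w} | z w. z \<in> {u, x} \<and> w \<in> N}"
    then obtain z w where e: "e = {z, w}" "z \<in> {u, x}" "{u, w} \<in> E"
      by (auto simp: N_def)
    moreover have "w \<notin> {u, x}"
      using e \<open>u \<notin> N\<close> \<open>x \<notin> N\<close> by (auto simp: N_def)
    ultimately show "e \<in> E"
      using both[of u w] by auto
  qed
  \<comment> \<open>\<open>finite N\<close> follows from \<open>card N = s + 1\<close>, since an
    infinite set has \<open>card\<close> equal to 0.\<close>
  then show thesis
    using that ux \<open>u \<notin> N\<close> \<open>x \<notin> N\<close> \<open>card N = s + 1\<close> card_E card.infinite by fastforce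
qed

section \<open>Isomorphism with the complete bipartite graph\<close>

lemma graph_isomorphic_complete_bipartite_2:
  assumes ux: "u \<noteq> x" "u \<notin> N" "x \<notin> N" and N: "finite N" "card N = n" "n > 0"
    and E: "E = {{z, w} | z w. z \<in> {u, x} \<and> w \<in> N}"
  shows "graph_isomorphic E (complete_bipartite 2 n)"
proof -
  obtain h where h: "bij_betw h N {..<n}"
    using ex_bij_betw_finite_nat[OF N(1)] N(2) by (auto simp: atLeast0LessThan)
  define \<phi> :: "'a \<Rightarrow> nat + nat" where
    "\<phi> w = (if w = u then Inl 0 else if w = x then Inl 1 else Inr (h w))" for w
  have \<phi>N: "\<phi> w = Inr (h w)" if "w \<in> N" for w
    using that ux by (auto simp: \<phi>_def)
  have \<phi>u: "\<phi> u = Inl 0" and \<phi>x: "\<phi> x = Inl 1"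
    using ux by (auto simp: \<phi>_def)
  have img: "h ` N = {..<n}" and inj: "inj_on h N"
    using h by (auto simp: bij_betw_def)
  \<comment> \<open>Vertices are read off from the edges, so \<open>u\<close> and \<open>x\<close>
    belong to \<open>\<Union>E\<close> only because \<open>N\<close> is nonempty.\<close>
  have "N \<noteq> {}"
    using N by auto
  then have VE: "\<Union>E = {u, x} \<union> N"
    by (auto simp: E)
  have K: "complete_bipartite 2 n = (\<Union>j<n. {{Inl 0, Inr j}, {Inl 1, Inr j}})"
    by (auto simp: complete_bipartite_def less_2_cases_iff)
  have VK: "\<Union>(complete_bipartite 2 n) = {Inl 0, Inl 1} \<union> Inr ` {..<n}"
    using N(3) by (auto simp: K)
  have "inj_on \<phi> ({u, x} \<union> N)"
    using inj by (auto simp: inj_on_def \<phi>N \<phi>u \<phi>x)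
  moreover have "\<phi> ` ({u, x} \<union> N) = {Inl 0, Inl 1} \<union> Inr ` {..<n}"
  proof -
    have "\<phi> ` N = Inr ` h ` N"
      unfolding image_image by (rule image_cong) (simp_all add: \<phi>N)
    then show ?thesis
      by (simp add: image_Un \<phi>u \<phi>x img)
  qed
  ultimately have "bij_betw \<phi> (\<Union>E) (\<Union>(complete_bipartite 2 n))"
    unfolding VE VK bij_betw_def by blast
  moreover have "(\<lambda>e. \<phi> ` e) ` E = complete_bipartite 2 n"
  proof (intro equalityI subsetI)
    fix k assume "k \<in> (\<lambda>e. \<phi> ` e) ` E"
    then obtain z w where "k = {\<phi> z, \<phi> w}" "z \<in> {u, x}" "w \<in> N"
      by (auto simp: E)
    moreover from this have "h w < n"
      using img by auto
    ultimately show "k \<in> complete_bipartite 2 n"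
      by (auto simp: K \<phi>u \<phi>x \<phi>N)
  next
    fix k assume "k \<in> complete_bipartite 2 n"
    then obtain i j where k: "k = {Inl i, Inr j}" "i < 2" "j < n"
      by (auto simp: complete_bipartite_def)
    obtain w where w: "w \<in> N" "h w = j"
      using img k(3) by (metis imageE lessThan_iff)
    obtain z where z: "z \<in> {u, x}" "\<phi> z = Inl i"
      using k(2) \<phi>u \<phi>x by (auto simp: less_2_cases_iff)
    have "k = \<phi> ` {z, w}"
      using k w z \<phi>N by simp
    moreover have "{z, w} \<in> E"
      using w z by (auto simp: E)
    ultimately show "k \<in> (\<lambda>e. \<phi> ` e) ` E"
      by (rule image_eqI)
  qed
  ultimately show ?thesis
    unfolding graph_isomorphic_def by blast
qed

section \<open>The complete bipartite graph attains the bound\<close>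

lemma complete_bipartite_image:
  "complete_bipartite m n = (\<lambda>(i, j). {Inl i, Inr j}) ` ({..<m} \<times> {..<n})"
  by (auto simp: complete_bipartite_def)

lemma inj_on_complete_bipartite_edge: "inj_on (\<lambda>(i, j). {Inl i, Inr j}) A"
  by (auto simp: inj_on_def doubleton_eq_iff)

lemma card_complete_bipartite: "card (complete_bipartite m n) = m * n"
  by (simp add: complete_bipartite_image card_image[OF inj_on_complete_bipartite_edge])

lemma fin_simple_graph_complete_bipartite: "fin_simple_graph (complete_bipartite m n)"
  unfolding fin_simple_graph_def by (auto simp: complete_bipartite_image)

text \<open>An edge is disjoint from the given one iff it differs from it at both ends. For
  \<open>m = 2\<close> and \<open>n = s + 1\<close> the count is exactly \<open>s\<close>.\<close>

lemma card_missing_complete_bipartite: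
  assumes "i < m" "j < n"
  shows "card (missing (complete_bipartite m n) {Inl i, Inr j}) = (m - 1) * (n - 1)"
proof -
  have "missing (complete_bipartite m n) {Inl i, Inr j} =
    (\<lambda>(i, j). {Inl i, Inr j}) ` (({..<m} - {i}) \<times> ({..<n} - {j}))"
    by (auto simp: missing_def complete_bipartite_image)
  then show ?thesis
    using assms by (simp add: card_image[OF inj_on_complete_bipartite_edge])
qed

lemma almost_intersecting_complete_bipartite_2:
  assumes "s > 0"
  shows "almost_intersecting 1 s (complete_bipartite 2 (s + 1))"
proof -
  have "card (missing (complete_bipartite 2 (s + 1)) e) = s"
    if "e \<in> complete_bipartite 2 (s + 1)" for e
  proof -
    obtain i j where "e = {Inl i, Inr j}" "i < 2" "j < s + 1"
      using \<open>e \<in> _\<close> by (auto simp: complete_bipartite_def)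
    then show ?thesis
      using card_missing_complete_bipartite[of i 2 j "s + 1"] by simp
  qed
  then show ?thesis
    using assms
    by (simp add: almost_intersecting_iff[OF fin_simple_graph_complete_bipartite])
qed

theorem theorem4p1:
  fixes s :: nat
  assumes "s > 13"
  shows "(\<forall>E :: 'a set set. fin_simple_graph E \<and> almost_intersecting 1 s E
            \<longrightarrow> card E \<le> 2 * s + 2)
       \<and> (\<forall>E :: 'a set set. fin_simple_graph E \<and> almost_intersecting 1 s E \<and> card E = 2 * s + 2
            \<longrightarrow> graph_isomorphic E (complete_bipartite 2 (s + 1)))
       \<and> (fin_simple_graph (complete_bipartite 2 (s + 1))
          \<and> almost_intersecting 1 s (complete_bipartite 2 (s + 1))
          \<and> card (complete_bipartite 2 (s + 1)) = 2 * s + 2)"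
proof (intro conjI allI impI)
  fix E :: "'a set set"
  assume E: "fin_simple_graph E \<and> almost_intersecting 1 s E"
  show "card E \<le> 2 * s + 2"
  proof (rule ccontr)
    assume "\<not> card E \<le> 2 * s + 2"
    then have "2 * s + 2 < card E"
      by simp
    then show False
      \<comment> \<open>The equality \<open>card E = 2 * s + 2\<close> supplied by
        \<open>extremal_structure\<close> contradicts the strict inequality.\<close>
      using E assms by (auto elim: extremal_structure[of E s])
  qed
next
  fix E :: "'a set set"
  assume E: "fin_simple_graph E \<and> almost_intersecting 1 s E \<and> card E = 2 * s + 2"
  then have G: "fin_simple_graph E" "almost_intersecting 1 s E" "2 * s + 2 \<le> card E"
    by auto
  obtain u x N where "u \<noteq> x" "u \<notin> N" "x \<notin> N" "finite N" "card N = s + 1"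
    "E = {{z, w} | z w. z \<in> {u, x} \<and> w \<in> N}"
    by (rule extremal_structure[OF G(1,2) assms G(3)])
  then show "graph_isomorphic E (complete_bipartite 2 (s + 1))"
    by (intro graph_isomorphic_complete_bipartite_2) simp_all
next
  show "fin_simple_graph (complete_bipartite 2 (s + 1))"
    by (rule fin_simple_graph_complete_bipartite)
  show "almost_intersecting 1 s (complete_bipartite 2 (s + 1))"
    using assms by (intro almost_intersecting_complete_bipartite_2) simp
  show "card (complete_bipartite 2 (s + 1)) = 2 * s + 2"
    by (simp add: card_complete_bipartite)
qed

end
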